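(* (i) Let $n\ge 5$ be odd and $\frac{n+1}{2}\le p\le n-2$. Put $r=\sum_{i=0}^{p-\frac{n-1}{2}}\binom{n}{i}$ and $s=\binom{p}{p-\frac{n-1}{2}}$. Then $b(Q_n^p)\le 2^{n-1}+\left\lfloor\frac{r-s}{2}\right\rfloor$. (ii) Let $n\ge 6$ be even and $\frac{n}{2}+1\le p\le n-2$. Put $r'=\sum_{i=0}^{p-\frac{n}{2}}\binom{n}{i}+\binom{n-1}{p-\frac{n}{2}}$ and $s'=\binom{p-1}{p-\frac{n}{2}}$. Then $b(Q_n^p)\le 2^{n-1}+\left\lfloor\frac{r'-s'}{2}\right\rfloor$.
   Context: The hypercube $Q_n$ has vertex set the power set $2^{[n]}$ of $[n]=\{1,\dots,n\}$, with $x,y$ adjacent iff $|x\triangle y|=1$. The $p$-th power $Q_n^p$ has the same vertex set, with distinct $x,y$ adjacent iff $|x\triangle y|\le p$. A b-coloring of a graph $G$ with $k$ colors is a proper vertex coloring with $k$ colors in which every color class contains a vertex adjacent to at least one vertex of every other color class; the b-chromatic number $b(G)$ is the largest $k$ for which $G$ has a b-coloring with $k$ colors. *)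

theory Defs
  imports "Graph_Theory.Pair_Digraph"
begin

(* Graphs are symmetric loop-free digraphs; an edge {u, v} is represented by
   the two arcs (u, v) and (v, u). *)

definition hypercube_power :: "nat \<Rightarrow> nat \<Rightarrow> nat set pair_pre_digraph" where
  "hypercube_power n p =
    \<lparr> pverts = Pow {1..n},
      parcs = {(x, y). x \<in> Pow {1..n} \<and> y \<in> Pow {1..n} \<and> x \<noteq> y \<and> card (sym_diff x y) \<le> p} \<rparr>"

lemma pair_graph_hypercube_power: "pair_graph (hypercube_power n p)"
proof
  show "finite (parcs (hypercube_power n p))"
    by (rule finite_subset[of _ "Pow {1..n} \<times> Pow {1..n}"])
       (auto simp: hypercube_power_def)
  show "symmetric (with_proj (hypercube_power n p))"
    unfolding symmetric_def by (auto simp: hypercube_power_def sym_def Un_commute)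
qed (auto simp: hypercube_power_def)

definition proper_coloring :: "'a pair_pre_digraph \<Rightarrow> nat \<Rightarrow> ('a \<Rightarrow> nat) \<Rightarrow> bool" where
  "proper_coloring G k c \<longleftrightarrow>
    c ` pverts G \<subseteq> {..<k} \<and> (\<forall>(u, v) \<in> parcs G. c u \<noteq> c v)"

(* The second condition makes every one of the k colour classes nonempty. *)
definition b_coloring :: "'a pair_pre_digraph \<Rightarrow> nat \<Rightarrow> ('a \<Rightarrow> nat) \<Rightarrow> bool" where
  "b_coloring G k c \<longleftrightarrow> proper_coloring G k c \<and>
    (\<forall>i<k. \<exists>u \<in> pverts G. c u = i \<and>
      (\<forall>j<k. j \<noteq> i \<longrightarrow> (\<exists>v \<in> pverts G. (u, v) \<in> parcs G \<and> c v = j)))"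

(* For a finite graph the set is finite (k is at most the number of vertices)
   and nonempty (a proper coloring with the least number of colors is a
   b-coloring), so that the maximum exists. *)
definition b_chromatic_number :: "'a pair_pre_digraph \<Rightarrow> nat" where
  "b_chromatic_number G = Max {k. \<exists>c. b_coloring G k c}"

end

theory Submission
  imports Defs
begin

text \<open>Let \<open>S\<close> be the set of vertices whose colour class is a singleton. Since all other classes have
  at least two elements, \<open>2 * k \<le> 2 ^ n + card S\<close>. Each vertex of \<open>S\<close> is within distance \<open>p\<close> of the
  b-vertex of every colour, so the neighbourhood of \<open>S\<close> of radius \<open>n - p - 1\<close> avoids the \<open>k\<close> antipodes of
  the b-vertices. If \<open>S\<close> had more than \<open>r - s\<close> elements, a vertex-isoperimetric inequality of Harper type
  would make this neighbourhood so large that \<open>k\<close> is already below the asserted bound.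

  The extremal sets of the isoperimetric inequality are a Hamming ball of radius \<open>t\<close> (in even dimension,
  the product of such a ball with a one-dimensional cube) from which the \<open>t\<close>-subsets of a fixed \<open>q\<close>-set
  are removed (from one of the two halves in even dimension). Their sizes obey Pascal's recursion in the dimension, which is why a single induction step
  on the dimension suffices.\<close>

section \<open>Vertex isoperimetry in the hypercube\<close>

text \<open>Toggling a set \<open>u\<close> of size at most one covers both staying put and moving
  along an edge, and makes neighbourhoods commute with translations
  (\<open>nbhd_shift\<close>).\<close>

definition nbhd :: "nat \<Rightarrow> nat set set \<Rightarrow> nat set set" where
  "nbhd n A = {sym_diff x u | x u. x \<in> A \<and> u \<subseteq> {1..n} \<and> card u \<le> 1}"

text \<open>Only sizes are recorded, so the induction on the dimension never handles the extremal
  sets themselves.\<close>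

definition expands :: "nat \<Rightarrow> nat \<Rightarrow> nat \<Rightarrow> bool" where
  "expands n a b \<longleftrightarrow> (\<forall>A \<subseteq> Pow {1..n}. a \<le> card A \<longrightarrow> b \<le> card (nbhd n A))"

lemma sym_diff_cancel: "sym_diff (sym_diff x u) u = x"
  by auto

lemma sym_diff_commute: "sym_diff (sym_diff x u) v = sym_diff (sym_diff x v) u"
  by auto

lemma inj_sym_diff: "inj_on (\<lambda>x. sym_diff x u) A"
  by (metis (no_types, lifting) inj_onI sym_diff_cancel)

lemma nbhdI: "x \<in> A \<Longrightarrow> u \<subseteq> {1..n} \<Longrightarrow> card u \<le> 1 \<Longrightarrow> sym_diff x u \<in> nbhd n A"
  unfolding nbhd_def by blast

lemma nbhd_sub: "A \<subseteq> nbhd n A"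
  using nbhdI[of _ A "{}" n] by auto

lemma nbhd_Pow: "A \<subseteq> Pow {1..n} \<Longrightarrow> nbhd n A \<subseteq> Pow {1..n}"
  unfolding nbhd_def by blast

lemma nbhd_mono: "A \<subseteq> B \<Longrightarrow> nbhd n A \<subseteq> nbhd n B"
  unfolding nbhd_def by blast

lemma nbhd_Un: "nbhd n (A \<union> B) = nbhd n A \<union> nbhd n B"
  unfolding nbhd_def by blast

lemma nbhd_shift: "nbhd n ((\<lambda>x. sym_diff x u) ` A) = (\<lambda>x. sym_diff x u) ` nbhd n A"
proof (intro subset_antisym subsetI)
  fix z assume "z \<in> nbhd n ((\<lambda>x. sym_diff x u) ` A)"
  then obtain x v where xv: "z = sym_diff (sym_diff x u) v" "x \<in> A" "v \<subseteq> {1..n}" "card v \<le> 1"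
    unfolding nbhd_def by auto
  show "z \<in> (\<lambda>x. sym_diff x u) ` nbhd n A"
    unfolding xv(1) sym_diff_commute[of x u v] by (rule imageI[OF nbhdI[OF xv(2-4)]])
next
  fix z assume "z \<in> (\<lambda>x. sym_diff x u) ` nbhd n A"
  then obtain y where "z = sym_diff y u" "y \<in> nbhd n A"
    by (rule imageE)
  then obtain x v where xv: "z = sym_diff (sym_diff x v) u" "x \<in> A" "v \<subseteq> {1..n}" "card v \<le> 1"
    unfolding nbhd_def by auto
  show "z \<in> nbhd n ((\<lambda>x. sym_diff x u) ` A)"
    unfolding xv(1) sym_diff_commute[of x v u] by (rule nbhdI[OF imageI[OF xv(2)] xv(3,4)])
qed

lemma shift_sub_nbhd:
  "u \<subseteq> {1..n} \<Longrightarrow> card u \<le> 1 \<Longrightarrow> (\<lambda>x. sym_diff x u) ` A \<subseteq> nbhd n A"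
  using nbhdI by blast

lemma finite_families: "A \<subseteq> Pow {1..n} \<Longrightarrow> finite (A :: nat set set)"
  by (rule finite_subset) auto

lemma expandsD: "expands n a b \<Longrightarrow> A \<subseteq> Pow {1..n} \<Longrightarrow> a \<le> card A \<Longrightarrow> b \<le> card (nbhd n A)"
  unfolding expands_def by blast

lemma expands_mono: "expands n a b \<Longrightarrow> a \<le> a' \<Longrightarrow> b' \<le> b \<Longrightarrow> expands n a' b'"
  unfolding expands_def by (meson le_trans)

text \<open>If \<open>X\<close> and \<open>Y\<close> are the two halves of a family with respect to the last coordinate, then
  \<open>nbhd n X \<union> Y\<close> and \<open>nbhd n Y \<union> X\<close> are the halves of its neighbourhood. As long as
  \<open>nbhd n Y \<subseteq> X\<close> fails, the pair is compressed along some \<open>t\<close> that toggles at most one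
  coordinate: \<open>X \<union> t Y\<close> and \<open>Y \<inter> t X\<close> have the same total size and no larger total
  neighbourhood. Afterwards \<open>X\<close> alone controls everything.\<close>

lemma expands_halves:
  assumes "expands n a0 b0" and "expands n a1 a0"
    and "X \<subseteq> Pow {1..n}" and "Y \<subseteq> Pow {1..n}"
    and "a0 + a1 - 1 \<le> card X + card Y"
  shows "a0 + b0 \<le> card (nbhd n X \<union> Y) + card (nbhd n Y \<union> X)"
  using assms(3-5)
proof (induction "card Y" arbitrary: X Y rule: less_induct)
  case less
  have fin: "finite X" "finite Y" "finite (nbhd n X)" "finite (nbhd n Y)"
    using less.prems(1,2)[THEN finite_families] less.prems(1,2)[THEN nbhd_Pow, THEN finite_families]
    by auto
  show ?case
  proof (cases "nbhd n Y \<subseteq> X")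
    case True
    have XY: "a0 \<le> card X"
    proof (rule ccontr)
      assume "\<not> a0 \<le> card X"
      \<comment> \<open>Pigeonhole: with at most \<open>a0 - 1\<close> points in \<open>X\<close>,
        at least \<open>a1\<close> remain for \<open>Y\<close>. This explains the \<open>- 1\<close>
        in the size hypothesis.\<close>
      then have "a1 \<le> card Y" using less.prems by linarith
      then have "a0 \<le> card (nbhd n Y)" using expandsD assms(2) less.prems by blast
      also have "\<dots> \<le> card X" using True fin card_mono by blast
      finally show False using \<open>\<not> a0 \<le> card X\<close> by simp
    qed
    then have "b0 \<le> card (nbhd n X)" using expandsD assms(1) less.prems by blast
    also have "\<dots> \<le> card (nbhd n X \<union> Y)" using fin by (simp add: card_mono)
    finally show ?thesis using XY card_mono[of "nbhd n Y \<union> X" X] fin by simp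
  next
    case False
    then obtain z where z: "z \<in> nbhd n Y" "z \<notin> X"
      by auto
    then obtain y u where yu: "y \<in> Y" "u \<subseteq> {1..n}" "card u \<le> 1" and zyu: "z = sym_diff y u"
      unfolding nbhd_def by auto
    define t where "t = (\<lambda>x. sym_diff x u)"
    have tt: "t (t x) = x" for x unfolding t_def by (rule sym_diff_cancel)
    have inj: "inj_on t Z" for Z unfolding t_def by (rule inj_sym_diff)
    have tPow: "t ` Z \<subseteq> Pow {1..n}" if "Z \<subseteq> Pow {1..n}" for Z
      using that yu(2) unfolding t_def by auto
    have tN: "nbhd n (t ` Z) = t ` nbhd n Z" for Z unfolding t_def by (rule nbhd_shift)
    have tsub: "t ` Z \<subseteq> nbhd n Z" for Z unfolding t_def by (rule shift_sub_nbhd[OF yu(2,3)])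
    have tsub': "Z \<subseteq> t ` nbhd n Z" for Z
      using tsub[of "t ` Z"] tN[of Z] by (simp add: image_image tt)
    have swap: "card (R \<inter> t ` P) = card (P \<inter> t ` R)" for R P :: "nat set set"
    proof -
      have eq: "t ` (R \<inter> t ` P) = P \<inter> t ` R"
        by (simp add: image_Int[OF inj_on_subset[OF inj subset_UNIV]] image_image tt Int_commute)
      have "card (t ` (R \<inter> t ` P)) = card (R \<inter> t ` P)" by (rule card_image[OF inj])
      from this[unfolded eq] show ?thesis by (rule sym)
    qed
    \<comment> \<open>Used twice: for \<open>X\<close> and \<open>Y\<close>, whose total size is
      preserved, and for the two neighbourhood halves \<open>?P\<close> and
      \<open>?R\<close>.\<close>
    have total: "card (P \<union> t ` R) + card (R \<inter> t ` P) = card P + card R"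
      if "finite P" "finite R" for P R :: "nat set set"
      using card_Un_Int[OF that(1) finite_imageI[OF that(2), of t]] card_image[OF inj, of R] swap[of R P]
      by linarith
    let ?X = "X \<union> t ` Y" and ?Y = "Y \<inter> t ` X"
    let ?P = "nbhd n X \<union> Y" and ?R = "nbhd n Y \<union> X"
    \<comment> \<open>Since \<open>z = t y\<close> lies outside \<open>X\<close>, the point
      \<open>y\<close> leaves the second family and the induction measure drops.\<close>
    have "y \<notin> t ` X"
    proof
      assume "y \<in> t ` X"
      then obtain x where "y = t x" "x \<in> X" by (rule imageE)
      then show False using z(2) zyu tt[of x] unfolding t_def by simp
    qed
    then have "card ?Y < card Y" using yu(1) fin by (intro psubset_card_mono) auto
    moreover have "card ?X + card ?Y = card X + card Y" using fin by (intro total)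
    ultimately have IH: "a0 + b0 \<le> card (nbhd n ?X \<union> ?Y) + card (nbhd n ?Y \<union> ?X)"
      using less.hyps[of ?Y ?X] less.prems tPow by auto
    have P': "nbhd n ?X \<union> ?Y \<subseteq> ?P \<union> t ` ?R"
      unfolding nbhd_Un tN by auto
    have "nbhd n ?Y \<subseteq> nbhd n Y" "nbhd n ?Y \<subseteq> t ` nbhd n X"
      using nbhd_mono[of ?Y Y n] nbhd_mono[of ?Y "t ` X" n] unfolding tN by simp_all
    then have R': "nbhd n ?Y \<union> ?X \<subseteq> ?R \<inter> t ` ?P"
      using tsub[of Y] tsub'[of X] by auto
    have "card (nbhd n ?X \<union> ?Y) + card (nbhd n ?Y \<union> ?X) \<le> card (?P \<union> t ` ?R) + card (?R \<inter> t ` ?P)"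
      using fin by (intro add_mono card_mono[OF _ P'] card_mono[OF _ R']) simp_all
    also have "\<dots> = card ?P + card ?R" using fin by (intro total) simp_all
    finally show ?thesis using IH by linarith
  qed
qed

section \<open>Passing to the next dimension\<close>

lemma card_halves:
  assumes "A \<subseteq> Pow {1..Suc n}"
  shows "card A = card (A \<inter> Pow {1..n}) + card {y \<in> Pow {1..n}. insert (Suc n) y \<in> A}"
proof -
  let ?Y = "{y \<in> Pow {1..n}. insert (Suc n) y \<in> A}"
  have A: "A = (A \<inter> Pow {1..n}) \<union> insert (Suc n) ` ?Y"
  proof
    show "A \<subseteq> (A \<inter> Pow {1..n}) \<union> insert (Suc n) ` ?Y"
    proof
      fix x assume x: "x \<in> A"
      then have sub: "x \<subseteq> insert (Suc n) {1..n}"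
        using assms by (auto simp: atLeastAtMostSuc_conv)
      show "x \<in> (A \<inter> Pow {1..n}) \<union> insert (Suc n) ` ?Y"
      proof (cases "Suc n \<in> x")
        case True
        then have "x = insert (Suc n) (x - {Suc n})" by blast
        moreover have "x - {Suc n} \<in> ?Y"
          using sub x True by (auto simp: insert_absorb)
        ultimately show ?thesis by blast
      qed (use sub x in auto)
    qed
  qed auto
  have "inj_on (insert (Suc n)) ?Y"
    by (auto intro!: inj_onI dest!: insert_ident[THEN iffD1, rotated 2])
  then have "card (insert (Suc n) ` ?Y) = card ?Y" by (rule card_image)
  moreover have "card A = card (A \<inter> Pow {1..n}) + card (insert (Suc n) ` ?Y)"
    by (subst A, rule card_Un_disjoint) (auto intro: finite_subset[of _ "Pow {1..n}"])
  ultimately show ?thesis by simp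
qed

text \<open>The premises chain \<open>a1\<close> to \<open>a0\<close> to \<open>b0\<close>, like
  three consecutive radii, so the sums in the conclusion imitate Pascal's recursion. The
  \<open>- 1\<close> is a gain that the refinements below spend.\<close>

lemma expands_Suc:
  assumes "expands n a0 b0" and "expands n a1 a0"
  shows "expands (Suc n) (a0 + a1 - 1) (a0 + b0)"
  unfolding expands_def
proof (intro allI impI)
  fix A assume A: "A \<subseteq> Pow {1..Suc n}" and a: "a0 + a1 - 1 \<le> card A"
  define X where "X = A \<inter> Pow {1..n}"
  define Y where "Y = {y \<in> Pow {1..n}. insert (Suc n) y \<in> A}"
  let ?N = "nbhd (Suc n) A"
  have "a0 + b0 \<le> card (nbhd n X \<union> Y) + card (nbhd n Y \<union> X)"
    using a card_halves[OF A] by (intro expands_halves[OF assms]) (auto simp: X_def Y_def)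
  also have "\<dots> \<le> card (?N \<inter> Pow {1..n}) + card {y \<in> Pow {1..n}. insert (Suc n) y \<in> ?N}"
  proof (intro add_mono card_mono)
    have sub: "{1..n} \<subseteq> {1..Suc n}" by auto
    have XY: "X \<subseteq> Pow {1..n}" "Y \<subseteq> Pow {1..n}" unfolding X_def Y_def by auto
    have "nbhd n X \<subseteq> ?N"
    proof
      fix z assume "z \<in> nbhd n X"
      then obtain x u where "z = sym_diff x u" "x \<in> X" "u \<subseteq> {1..n}" "card u \<le> 1"
        unfolding nbhd_def by blast
      then show "z \<in> ?N" using nbhdI[of x A u "Suc n"] sub unfolding X_def by blast
    qed
    moreover have "Y \<subseteq> ?N"
    proof
      fix y assume y: "y \<in> Y"
      then have "sym_diff (insert (Suc n) y) {Suc n} = y" unfolding Y_def by auto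
      moreover have "sym_diff (insert (Suc n) y) {Suc n} \<in> ?N"
        by (rule nbhdI) (use y in \<open>auto simp: Y_def\<close>)
      ultimately show "y \<in> ?N" by metis
    qed
    ultimately show "nbhd n X \<union> Y \<subseteq> ?N \<inter> Pow {1..n}"
      using nbhd_Pow[OF XY(1)] XY by blast
    have "insert (Suc n) z \<in> ?N" if z: "z \<in> nbhd n Y" for z
    proof -
      obtain y u where yu: "z = sym_diff y u" "y \<in> Y" "u \<subseteq> {1..n}" "card u \<le> 1"
        using z unfolding nbhd_def by blast
      have "sym_diff (insert (Suc n) y) u = insert (Suc n) z" using yu by auto
      moreover have "sym_diff (insert (Suc n) y) u \<in> ?N"
        by (rule nbhdI) (use yu sub in \<open>auto simp: Y_def\<close>)
      ultimately show ?thesis by metis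
    qed
    moreover have "insert (Suc n) x \<in> ?N" if x: "x \<in> X" for x
    proof -
      have "sym_diff x {Suc n} = insert (Suc n) x" using x unfolding X_def by auto
      moreover have "sym_diff x {Suc n} \<in> ?N"
        by (rule nbhdI) (use x in \<open>auto simp: X_def\<close>)
      ultimately show ?thesis by metis
    qed
    ultimately show "nbhd n Y \<union> X \<subseteq> {y \<in> Pow {1..n}. insert (Suc n) y \<in> ?N}"
      using nbhd_Pow[OF XY(2)] XY by blast
  qed auto
  also have "\<dots> = card ?N" using card_halves[OF nbhd_Pow[OF A]] by simp
  finally show "a0 + b0 \<le> card ?N" .
qed

lemma expands_refl: "expands n a a"
  unfolding expands_def
  by (meson card_mono finite_families le_trans nbhd_Pow nbhd_sub)

lemma expands_point: "expands n 1 (n + 1)"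
proof (induction n)
  case (Suc n)
  show ?case using expands_Suc[OF expands_mono[OF Suc, of 1] expands_refl[of n 1]] 
    by (simp add: expands_mono Suc)
qed (use expands_refl in simp)

text \<open>The extremal pair is an edge. In the induction step the smaller half needs only one
  point, as one point already expands to two.\<close>

lemma expands_edge: "expands (Suc n) 2 (2 * (n + 1))"
proof (induction n)
  case (Suc n)
  have "expands (Suc n) 1 2" using expands_point[of "Suc n"] by (rule expands_mono) auto
  from expands_Suc[OF Suc this] show ?case by (simp add: eval_nat_numeral)
qed (use expands_refl[of 1 2] in simp)

section \<open>Expansion at ball sizes, with and without a deficit\<close>

text \<open>Size of a radius-\<open>t\<close> Hamming ball in dimension \<open>n - j\<close> times a
  \<open>j\<close>-dimensional cube; \<open>j = 0\<close> serves odd and \<open>j = 1\<close> even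
  dimension.\<close>

definition hball :: "nat \<Rightarrow> nat \<Rightarrow> nat \<Rightarrow> nat" where
  "hball j n t = 2 ^ j * (\<Sum>i\<le>t. (n - j) choose i)"

lemma sum_choose_Suc: "(\<Sum>i\<le>Suc t. Suc n choose i) = (\<Sum>i\<le>Suc t. n choose i) + (\<Sum>i\<le>t. n choose i)"
  by (induction t) auto

lemma hball_Suc: "j \<le> n \<Longrightarrow> hball j (Suc n) (Suc t) = hball j n (Suc t) + hball j n t"
  unfolding hball_def by (simp only: Suc_diff_le sum_choose_Suc distrib_left)

lemma hball_0: "hball j n 0 = 2 ^ j"
  by (simp add: hball_def)

lemma hball_diag: "hball j j t = 2 ^ j"
  unfolding hball_def by (induction t) auto

lemma choose_le_hball: "q \<le> n - j \<Longrightarrow> q choose t \<le> hball j n t"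
proof -
  assume "q \<le> n - j"
  then have "q choose t \<le> (n - j) choose t" by (rule binomial_right_mono)
  also have "\<dots> \<le> (\<Sum>i\<le>t. (n - j) choose i)" by (rule member_le_sum) auto
  also have "\<dots> \<le> hball j n t" unfolding hball_def by simp
  finally show ?thesis .
qed

lemma expands_base:
  assumes "j \<le> 1" "j \<le> n"
  shows "expands n (2 ^ j) (hball j n 1)"
proof (cases "j = 0")
  case True
  then show ?thesis using expands_point by (simp add: hball_def)
next
  case False
  with assms obtain n' where "n = Suc n'" "j = 1" by (cases n) auto
  then show ?thesis using expands_edge by (simp add: hball_def)
qed

text \<open>Radii \<open>t\<close> and \<open>t - 1\<close> in dimension \<open>n\<close> combine by
  \<open>hball_Suc\<close> into radius \<open>t\<close> in dimension \<open>n + 1\<close>.\<close>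

lemma expands_hball:
  assumes "j \<le> 1" "j \<le> n"
  shows "expands n (hball j n t) (hball j n (Suc t))"
  using assms(2)
proof (induction n arbitrary: t rule: dec_induct)
  case base
  then show ?case by (simp add: hball_diag expands_refl)
next
  case (step n)
  show ?case
  proof (cases t)
    case 0
    then show ?thesis using expands_base[of j "Suc n"] assms(1) step by (simp add: hball_0)
  next
    case (Suc t')
    from expands_Suc[OF step.IH[of t] step.IH[of t', folded Suc]] show ?thesis
      by (rule expands_mono) (use step Suc in \<open>simp_all add: hball_Suc\<close>)
  qed
qed

text \<open>The deficit \<open>q choose t\<close> obeys Pascal's rule too, so \<open>q\<close> and
  \<open>n\<close> rise together. For \<open>t = 0\<close> and \<open>j = 0\<close> the threshold
  would be zero, with the empty family as a counterexample.\<close>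

lemma expands_hball_minus:
  assumes "j \<le> 1" "j \<le> n" "q \<le> n - j" "t \<ge> 1"
  shows "expands n (hball j n t - (q choose t)) (hball j n (Suc t) - (q choose Suc t))"
  using assms(2-4)
proof (induction q arbitrary: n t)
  case 0
  then show ?case using expands_hball[OF assms(1), of n t] by (simp add: binomial_eq_0)
next
  case (Suc q)
  then obtain n' where n: "n = Suc n'" "j \<le> n'" "q \<le> n' - j" by (cases n) auto
  obtain t' where t: "t = Suc t'" using Suc.prems by (cases t) auto
  note le = choose_le_hball[OF n(3)]
  have b: "expands n' (hball j n' t - (q choose t)) (hball j n' (Suc t) - (q choose Suc t))"
    using Suc.IH n t by simp
  show ?case
  proof (cases "t' = 0")
    case True
    \<comment> \<open>At radius zero the full \<open>2 ^ j\<close> replaces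
      \<open>2 ^ j - 1\<close>; the \<open>- 1\<close> of \<open>expands_Suc\<close> supplies the
      missing unit.\<close>
    have "expands n' (2 ^ j) (hball j n' t - (q choose t))"
      using expands_base[OF assms(1) n(2)] by (rule expands_mono) (simp_all add: t True)
    from expands_Suc[OF b this] show ?thesis unfolding n(1)
      by (rule expands_mono)
        (use le[of t] le[of t'] le[of "Suc t"] in \<open>simp_all add: n hball_Suc t True hball_0\<close>)
  next
    case False
    then have "expands n' (hball j n' t' - (q choose t')) (hball j n' t - (q choose t))"
      using Suc.IH[of n' t'] n t by simp
    from expands_Suc[OF b this] show ?thesis unfolding n(1)
      by (rule expands_mono)
        (use le[of t] le[of t'] le[of "Suc t"] in \<open>simp_all add: n hball_Suc t\<close>)
  qed
qed

text \<open>One surplus point persists. Both thresholds in the step carry \<open>+ 1\<close>, and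
  the \<open>- 1\<close> of \<open>expands_Suc\<close> cancels one of them; the surplus in the
  conclusion comes from \<open>a0\<close>, so the first premise may use the weaker bound of
  \<open>expands_hball_minus\<close>.\<close>

lemma expands_hball_minus_strict:
  assumes "j \<le> 1" "j \<le> n" "q \<le> n - j" "t < q"
  shows "expands n (hball j n t - (q choose t) + 1) (hball j n (Suc t) - (q choose Suc t) + 1)"
  using assms(2-4)
proof (induction t arbitrary: n q)
  case 0
  from expands_base[OF assms(1) 0(1)] show ?case
    by (rule expands_mono) (use 0 choose_le_hball[of q n j 1] in \<open>simp_all add: hball_0\<close>)
next
  case (Suc t)
  then obtain n' q' where n: "n = Suc n'" "q = Suc q'" "j \<le> n'" "q' \<le> n' - j" "t < q'"
    by (cases n; cases q) auto
  note le = choose_le_hball[OF n(4)]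
  have b: "expands n' (hball j n' (Suc t) - (q' choose Suc t) + 1)
      (hball j n' (Suc (Suc t)) - (q' choose Suc (Suc t)))"
    using expands_hball_minus[OF assms(1) n(3,4), of "Suc t"] by (rule expands_mono) auto
  from expands_Suc[OF b Suc.IH[OF n(3-5)]] show ?case unfolding n(1,2)
    by (rule expands_mono)
      (use le[of t] le[of "Suc t"] le[of "Suc (Suc t)"] in \<open>simp_all add: n hball_Suc\<close>)
qed

section \<open>Iterated neighbourhoods\<close>

lemma funpow_nbhdE:
  assumes "z \<in> (nbhd n ^^ m) A"
  obtains x u where "x \<in> A" "u \<subseteq> {1..n}" "card u \<le> m" "z = sym_diff x u"
proof -
  have "\<exists>x u. x \<in> A \<and> u \<subseteq> {1..n} \<and> card u \<le> m \<and> z = sym_diff x u"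
    using assms
  proof (induction m arbitrary: z)
    case 0
    then show ?case by (intro exI[of _ z] exI[of _ "{}"]) auto
  next
    case (Suc m)
    then have "z \<in> nbhd n ((nbhd n ^^ m) A)" by simp
    then obtain y v where y: "y \<in> (nbhd n ^^ m) A" and v: "v \<subseteq> {1..n}" "card v \<le> 1" "z = sym_diff y v"
      unfolding nbhd_def by auto
    from Suc.IH[OF y] obtain x u where x: "x \<in> A" "u \<subseteq> {1..n}" "card u \<le> m" "y = sym_diff x u"
      by (elim exE conjE)
    have "card (sym_diff u v) \<le> card (u \<union> v)"
      using x(2) v(1) by (intro card_mono) (auto intro: finite_subset)
    also have "\<dots> \<le> Suc m" using card_Un_le[of u v] x(3) v(2) by linarith
    finally have "card (sym_diff u v) \<le> Suc m" .
    moreover have "z = sym_diff x (sym_diff u v)" unfolding v(3) x(4) by auto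
    moreover have "sym_diff u v \<subseteq> {1..n}" using x(2) v(1) by auto
    ultimately show ?case using x(1) by (intro exI conjI)
  qed
  then show ?thesis using that by (elim exE conjE)
qed

lemma funpow_nbhd_Pow: "A \<subseteq> Pow {1..n} \<Longrightarrow> (nbhd n ^^ m) A \<subseteq> Pow {1..n}"
proof (induction m)
  case (Suc m)
  from nbhd_Pow[OF Suc.IH[OF Suc.prems]] show ?case by simp
qed simp

lemma funpow_nbhd_hball_minus:
  assumes "j \<le> 1" "j \<le> n" "q \<le> n - j" "t \<ge> 1" "A \<subseteq> Pow {1..n}"
    and "hball j n t - (q choose t) \<le> card A"
  shows "hball j n (t + m) - (q choose (t + m)) \<le> card ((nbhd n ^^ m) A)"
proof (induction m)
  case (Suc m)
  then show ?case
    using expandsD[OF expands_hball_minus[OF assms(1-3), of "t + m"] funpow_nbhd_Pow[OF assms(5)]] assms(4)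
    by simp
qed (use assms(6) in simp)

lemma funpow_nbhd_hball_minus_strict:
  assumes "j \<le> 1" "j \<le> n" "q \<le> n - j" "t + m \<le> q" "A \<subseteq> Pow {1..n}"
    and "hball j n t - (q choose t) < card A"
  shows "hball j n (t + m) - (q choose (t + m)) < card ((nbhd n ^^ m) A)"
  using assms(4)
proof (induction m)
  case (Suc m)
  then show ?case
    using expandsD[OF expands_hball_minus_strict[OF assms(1-3), of "t + m"] funpow_nbhd_Pow[OF assms(5), of m]]
    by simp
qed (use assms(6) in simp)

section \<open>b-colorings of powers of the hypercube\<close>

lemma pverts_hypercube_power: "pverts (hypercube_power n p) = Pow {1..n}"
  by (simp add: hypercube_power_def)

lemma parcs_hypercube_power:
  "(x, y) \<in> parcs (hypercube_power n p) \<longleftrightarrow>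
    x \<in> Pow {1..n} \<and> y \<in> Pow {1..n} \<and> x \<noteq> y \<and> card (sym_diff x y) \<le> p"
  by (simp add: hypercube_power_def)

text \<open>Separates the colouring from isoperimetry: \<open>N\<close> is consulted only if more
  than \<open>d\<close> classes are singletons, as otherwise counting class sizes suffices.\<close>

lemma b_coloring_bound:
  assumes bc: "b_coloring (hypercube_power n p) k c" and "p < n"
    and N: "\<And>A. A \<subseteq> Pow {1..n} \<Longrightarrow> d < card A \<Longrightarrow>
      2 ^ n \<le> 2 * card ((nbhd n ^^ (n - p - 1)) A) + d"
  shows "2 * k \<le> 2 ^ n + d"
proof -
  define V where "V = Pow {1..n}"
  define cls where "cls i = {v \<in> V. c v = i}" for i
  define S where "S = {v \<in> V. \<forall>w \<in> V. c w = c v \<longrightarrow> w = v}"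
  let ?N = "(nbhd n ^^ (n - p - 1)) S"
  have finV: "finite V" unfolding V_def by simp
  have cardV: "card V = 2 ^ n" unfolding V_def by (simp add: card_Pow)
  have SV: "S \<subseteq> V" unfolding S_def by auto
  have cV: "c v < k" if "v \<in> V" for v
    using bc that
    unfolding b_coloring_def proper_coloring_def pverts_hypercube_power V_def by blast
  have "\<forall>i<k. \<exists>u \<in> V. c u = i \<and>
      (\<forall>j<k. j \<noteq> i \<longrightarrow> (\<exists>v \<in> V. (u, v) \<in> parcs (hypercube_power n p) \<and> c v = j))"
    using bc unfolding b_coloring_def pverts_hypercube_power V_def by (rule conjunct2)
  then obtain b where b0: "\<And>i. i < k \<Longrightarrow> b i \<in> V \<and> c (b i) = i \<and>
      (\<forall>j<k. j \<noteq> i \<longrightarrow> (\<exists>v \<in> V. (b i, v) \<in> parcs (hypercube_power n p) \<and> c v = j))"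
    by metis
  have b: "b i \<in> V \<and> c (b i) = i \<and>
      (\<forall>j<k. j \<noteq> i \<longrightarrow> (\<exists>v \<in> V. card (sym_diff (b i) v) \<le> p \<and> c v = j))" if "i < k" for i
    using b0[OF that] unfolding parcs_hypercube_power by metis
  have bV: "b i \<in> V" and bcol: "c (b i) = i" if "i < k" for i
    using b[OF that] by (rule conjunct1, elim conjE)
  have part: "card X = (\<Sum>i<k. card (X \<inter> cls i))" if "X \<subseteq> V" for X
  proof -
    have "X = (\<Union>i<k. X \<inter> cls i)" using that cV unfolding cls_def by auto
    then have "card X = card (\<Union>i<k. X \<inter> cls i)" by simp
    also have "\<dots> = (\<Sum>i<k. card (X \<inter> cls i))"
      by (rule card_UN_disjoint) (use that finV in \<open>auto simp: cls_def intro: finite_subset\<close>)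
    finally show ?thesis .
  qed
  \<comment> \<open>A singleton class is counted again in \<open>S\<close>, so every colour
    contributes at least two.\<close>
  have two: "2 \<le> card (V \<inter> cls i) + card (S \<inter> cls i)" if "i < k" for i
  proof -
    have fin: "finite (cls i)" "V \<inter> cls i = cls i" using finV unfolding cls_def by auto
    have "b i \<in> cls i" using b[OF that] unfolding cls_def by simp
    then have pos: "card (cls i) \<ge> 1"
      using card_mono[of "cls i" "{b i}"] fin by simp
    show ?thesis
    proof (cases "card (cls i) = 1")
      case True
      then obtain v where v: "cls i = {v}" by (rule card_1_singletonE)
      have iff: "w \<in> V \<and> c w = i \<longleftrightarrow> w = v" for w
        using v unfolding cls_def by (simp add: set_eq_iff)
      have v': "v \<in> V \<and> c v = i" by (rule iff[THEN iffD2]) (rule refl)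
      have "v \<in> S" unfolding S_def
      proof (rule CollectI, intro conjI ballI impI)
        show "v \<in> V" using v' by (rule conjunct1)
        fix w assume "w \<in> V" "c w = c v"
        then have "w \<in> V \<and> c w = i" using v' by simp
        then show "w = v" by (rule iff[THEN iffD1])
      qed
      then have "S \<inter> cls i = {v}" unfolding v by simp
      then show ?thesis using True fin by simp
    qed (use pos fin in simp)
  qed
  have "2 * k = (\<Sum>i<k. 2)" by simp
  also have "\<dots> \<le> (\<Sum>i<k. card (V \<inter> cls i) + card (S \<inter> cls i))"
    using two by (intro sum_mono) simp
  also have "\<dots> = 2 ^ n + card S"
    using part[of V] part[OF SV] cardV by (simp add: sum.distrib)
  finally have size: "2 * k \<le> 2 ^ n + card S" .

  \<comment> \<open>As the only vertex of its colour, \<open>x\<close> must itself be the neighbour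
    that each other b-vertex has in that colour.\<close>
  have close: "card (sym_diff x (b i)) \<le> p" if x: "x \<in> S" and i: "i < k" for x i
  proof -
    have xV: "x \<in> V" and single: "\<And>w. w \<in> V \<Longrightarrow> c w = c x \<Longrightarrow> w = x"
      using x unfolding S_def by auto
    show ?thesis
    proof (cases "c x = i")
      case True
      then have "b i = x" using b[OF i] by (intro single) simp_all
      then show ?thesis by simp
    next
      case False
      then obtain v where v: "v \<in> V" "card (sym_diff (b i) v) \<le> p" "c v = c x"
        using b[OF i] cV[OF xV] by metis
      have "v = x" by (rule single[OF v(1,3)])
      then show ?thesis using v(2) by (simp add: Un_commute)
    qed
  qed
  let ?B = "(\<lambda>i. {1..n} - b i) ` {..<k}"
  have disj: "?N \<inter> ?B = {}"
  proof (rule ccontr)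
    assume "?N \<inter> ?B \<noteq> {}"
    then obtain i where i: "i < k" "{1..n} - b i \<in> ?N" by auto
    from i(2) obtain x u where xu: "x \<in> S" "u \<subseteq> {1..n}" "card u \<le> n - p - 1"
      "{1..n} - b i = sym_diff x u" by (rule funpow_nbhdE)
    have bi: "b i \<subseteq> {1..n}" "x \<subseteq> {1..n}" using b[OF i(1)] SV xu(1) unfolding V_def by auto
    \<comment> \<open>An antipode of \<open>b i\<close> this near to \<open>x\<close> would cover
      all \<open>n\<close> coordinates by at most \<open>p + (n - p - 1)\<close> of them.\<close>
    have "{1..n} \<subseteq> sym_diff x (b i) \<union> u" using xu(4) bi by auto
    then have "card {1..n} \<le> card (sym_diff x (b i) \<union> u)"
      using bi xu(2) by (intro card_mono) (auto intro: finite_subset)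
    also have "\<dots> \<le> p + (n - p - 1)"
      using card_Un_le[of "sym_diff x (b i)" u] close[OF xu(1) i(1)] xu(3) by linarith
    finally show False using \<open>p < n\<close> by simp
  qed
  have "inj_on (\<lambda>i. {1..n} - b i) {..<k}"
  proof (rule inj_onI)
    fix i i' assume ii: "i \<in> {..<k}" "i' \<in> {..<k}" "{1..n} - b i = {1..n} - b i'"
    have "b i \<subseteq> {1..n}" "b i' \<subseteq> {1..n}"
      using ii(1,2)[unfolded lessThan_iff, THEN bV] unfolding V_def by (simp_all only: Pow_iff)
    then have eq: "b i = b i'" using ii(3) by (metis double_diff subset_refl)
    have "i = c (b i)" using ii(1) by (simp only: bcol lessThan_iff)
    also have "\<dots> = i'" unfolding eq using ii(2) by (simp only: bcol lessThan_iff)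
    finally show "i = i'" .
  qed
  then have cardB: "card ?B = k" by (simp add: card_image)
  have NV: "?N \<subseteq> V" unfolding V_def by (rule funpow_nbhd_Pow) (use SV in \<open>simp add: V_def\<close>)
  then have finN: "finite ?N" using finV by (rule finite_subset)
  have "?B \<subseteq> V" unfolding V_def by auto
  then have "card (?N \<union> ?B) \<le> card V" using NV finV by (intro card_mono Un_least)
  moreover have "card (?N \<union> ?B) = card ?N + card ?B"
    using disj finN by (intro card_Un_disjoint) simp_all
  ultimately have sum: "card ?N + k \<le> 2 ^ n" using cardV cardB by linarith
  show ?thesis
  proof (cases "d < card S")
    case True
    then have "2 ^ n \<le> 2 * card ?N + d" using SV unfolding V_def by (intro N)
    then show ?thesis using sum by linarith
  qed (use size in linarith)
qed

section \<open>The antipodal b-coloring and the maximum\<close>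

text \<open>Guarantees that the maximum is over a nonempty set. The classes are the antipodal pairs:
  the distances from a vertex to the two members of another pair sum to
  \<open>n \<le> 2 * p + 1\<close>, so one of them is at most \<open>p\<close>.\<close>

lemma b_coloring_antipodal:
  assumes "n \<ge> 1" "p < n" "n \<le> 2 * p + 1"
  shows "\<exists>c. b_coloring (hypercube_power n p) (2 ^ (n - 1)) c"
proof -
  \<comment> \<open>The member of the antipodal pair of \<open>x\<close> that omits
    \<open>n\<close>.\<close>
  define rep where "rep x = (if n \<in> x then {1..n} - x else x)" for x
  have rep_Pow: "rep x \<in> Pow {1..n - 1}" if "x \<subseteq> {1..n}" for x
  proof (intro PowI subsetI)
    fix i assume "i \<in> rep x"
    then have "i \<in> {1..n}" "i \<noteq> n" using that unfolding rep_def by (auto split: if_splits)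
    then show "i \<in> {1..n - 1}" by auto
  qed
  have sub: "x \<subseteq> {1..n}" "n \<notin> x" if "x \<in> Pow {1..n - 1}" for x
  proof -
    have "{1..n - 1} \<subseteq> {1..n}" "n \<notin> {1..n - 1}" using assms(1) by auto
    then show "x \<subseteq> {1..n}" "n \<notin> x" using that by blast+
  qed
  have rep_eq: "y = x \<or> y = {1..n} - x" if "rep x = rep y" "x \<subseteq> {1..n}" "y \<subseteq> {1..n}" for x y
    using that unfolding rep_def by (auto split: if_splits)
  have rep_id: "rep x = x" "rep ({1..n} - x) = x" if "x \<in> Pow {1..n - 1}" for x
    using sub[OF that] assms(1) unfolding rep_def by auto
  obtain e where e: "bij_betw e (Pow {1..n - 1}) {0..<card (Pow {1..n - 1})}"
    using ex_bij_betw_finite_nat[of "Pow {1..n - 1}"] by auto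
  then have e: "bij_betw e (Pow {1..n - 1}) {..<2 ^ (n - 1)}"
    by (simp add: card_Pow atLeast0LessThan)
  define c where "c x = e (rep x)" for x
  have c_lt: "c x < 2 ^ (n - 1)" if "x \<subseteq> {1..n}" for x
    using bij_betwE[OF e] rep_Pow[OF that] unfolding c_def by auto
  have c_eq: "rep x = rep y" if "c x = c y" "x \<subseteq> {1..n}" "y \<subseteq> {1..n}" for x y
    using that rep_Pow bij_betw_imp_inj_on[OF e] unfolding c_def by (meson inj_onD)
  have "proper_coloring (hypercube_power n p) (2 ^ (n - 1)) c"
  proof -
    have "c x \<noteq> c y" if xy: "(x, y) \<in> parcs (hypercube_power n p)" for x y
    proof
      assume eq: "c x = c y"
      have x: "x \<subseteq> {1..n}" and y: "y \<subseteq> {1..n}" and "x \<noteq> y" and p: "card (sym_diff x y) \<le> p"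
        using xy unfolding parcs_hypercube_power by simp_all
      then have "y = {1..n} - x" using rep_eq[OF c_eq[OF eq x y] x y] by simp
      then have "sym_diff x y = {1..n}" using x by auto
      then show False using p assms(2) by simp
    qed
    moreover have "c ` pverts (hypercube_power n p) \<subseteq> {..<2 ^ (n - 1)}"
      unfolding pverts_hypercube_power using c_lt by auto
    ultimately show ?thesis unfolding proper_coloring_def by (intro conjI ballI) auto
  qed
  moreover have "\<exists>u \<in> Pow {1..n}. c u = i \<and> (\<forall>j<2 ^ (n - 1). j \<noteq> i \<longrightarrow>
      (\<exists>v \<in> Pow {1..n}. (u, v) \<in> parcs (hypercube_power n p) \<and> c v = j))" if i: "i < 2 ^ (n - 1)" for i
  proof -
    have ex: "\<exists>u \<in> Pow {1..n - 1}. e u = l" if "l < 2 ^ (n - 1)" for l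
      using bij_betw_imp_surj_on[OF e] that by (metis imageE lessThan_iff)
    from ex[OF i] obtain u where u: "u \<in> Pow {1..n - 1}" "e u = i" by (rule bexE)
    have cu: "c u = i" "u \<in> Pow {1..n}"
      using rep_id(1)[OF u(1)] u(2) sub(1)[OF u(1)] unfolding c_def by auto
    have "\<exists>v \<in> Pow {1..n}. (u, v) \<in> parcs (hypercube_power n p) \<and> c v = j"
      if j: "j < 2 ^ (n - 1)" "j \<noteq> i" for j
    proof -
      from ex[OF j(1)] obtain v where v: "v \<in> Pow {1..n - 1}" "e v = j" by (rule bexE)
      let ?w = "{1..n} - v"
      have "sym_diff u v \<union> sym_diff u ?w = {1..n}" "sym_diff u v \<inter> sym_diff u ?w = {}"
        using sub(1)[OF u(1)] sub(1)[OF v(1)] by auto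
      moreover have "finite u" "finite v"
        using u(1) v(1) by (auto intro: finite_subset)
      ultimately have "card (sym_diff u v) + card (sym_diff u ?w) = n"
        using card_Un_disjoint[of "sym_diff u v" "sym_diff u ?w"] by simp
      then have "card (sym_diff u v) \<le> p \<or> card (sym_diff u ?w) \<le> p"
        using assms(3) by linarith
      moreover have "c v = j" "c ?w = j" using rep_id[OF v(1)] v(2) unfolding c_def by auto
      moreover have "v \<in> Pow {1..n}" "?w \<in> Pow {1..n}" using sub(1)[OF v(1)] by auto
      moreover have "u \<noteq> w" if "c w = j" for w using that cu(1) j(2) by auto
      ultimately show ?thesis using cu(2) unfolding parcs_hypercube_power by metis
    qed
    then show ?thesis using cu by blast
  qed
  ultimately have "b_coloring (hypercube_power n p) (2 ^ (n - 1)) c"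
    unfolding b_coloring_def pverts_hypercube_power by blast
  then show ?thesis by blast
qed

lemma b_chromatic_number_le:
  assumes "p < n" "n \<le> 2 * p + 1"
    and "\<And>k c. b_coloring (hypercube_power n p) k c \<Longrightarrow> 2 * k \<le> 2 ^ n + d"
  shows "int (b_chromatic_number (hypercube_power n p)) \<le> 2 ^ (n - 1) + \<lfloor>real d / 2\<rfloor>"
proof -
  let ?K = "{k. \<exists>c. b_coloring (hypercube_power n p) k c}"
  have "?K \<subseteq> {..2 ^ n + d}" using assms(3) by fastforce
  then have "finite ?K" by (rule finite_subset) simp
  moreover have "?K \<noteq> {}" using b_coloring_antipodal[of n p] assms(1,2) by auto
  ultimately have "Max ?K \<in> ?K" by (rule Max_in)
  then have "2 * Max ?K \<le> 2 ^ n + d" using assms(3) by auto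
  moreover have "(2::nat) ^ n = 2 * 2 ^ (n - 1)" using assms(1) by (simp flip: power_Suc)
  ultimately have "Max ?K \<le> 2 ^ (n - 1) + d div 2" by linarith
  then have "int (Max ?K) \<le> int (2 ^ (n - 1) + d div 2)" by (rule of_nat_mono)
  also have "\<dots> = 2 ^ (n - 1) + \<lfloor>real d / 2\<rfloor>"
    using floor_divide_of_nat_eq[of d 2, where ?'a = real] by simp
  finally show ?thesis unfolding b_chromatic_number_def .
qed

section \<open>The bound\<close>

lemma three_central_binomial_le: "3 * ((2 * Suc t) choose Suc t) \<le> 4 ^ Suc t + 2"
proof (induction t)
  case (Suc t)
  let ?c = "(2 * Suc t) choose Suc t"
  have "Suc (Suc t) * ((2 * Suc (Suc t)) choose Suc (Suc t)) = 2 * (2 * t + 3) * ?c"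
    using Suc_times_binomial[of "Suc t" "2 * Suc t"] binomial_symmetric[of "Suc t" "Suc (2 * Suc t)"]
    by (simp add: algebra_simps)
  then have "Suc (Suc t) * (3 * ((2 * Suc (Suc t)) choose Suc (Suc t))) = (4 * t + 6) * (3 * ?c)"
    by (simp add: algebra_simps)
  also have "\<dots> \<le> (4 * t + 6) * (4 ^ Suc t + 2)" using Suc.IH by (intro mult_left_mono) auto
  also have "\<dots> \<le> Suc (Suc t) * (4 ^ Suc (Suc t) + 2)"
  proof -
    have "3 * t + 4 \<le> 4 ^ Suc t" for t :: nat by (induction t) auto
    from this[of t] show ?thesis by (simp add: algebra_simps)
  qed
  finally show ?case by (simp only: mult_le_cancel1)
qed (simp add: eval_nat_numeral)

text \<open>This is \<open>3 * s \<le> r + 2\<close>, what remains to be shown once the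
  neighbourhood has more than \<open>2 ^ (n - 1) - s\<close> points. Raising \<open>h\<close>
  applies Pascal's rule twice on the right and once on the left; the diagonal \<open>t = h\<close>
  is the central binomial estimate.\<close>

lemma three_choose_le:
  assumes "2 \<le> t" "t \<le> h"
  shows "3 * ((h + t) choose t) \<le> (\<Sum>i\<le>t. (2 * h + 1) choose i) + 2"
  using assms(2,1)
proof (induction h arbitrary: t)
  case (Suc h)
  define R where "R t = (\<Sum>i\<le>t. (2 * h + 1) choose i)" for t
  obtain t' where t: "t = Suc (Suc t')" using Suc.prems that[of "t - 2"] by simp
  show ?case
  proof (cases "t = Suc h")
    case True
    have "(4::nat) ^ Suc h = 2 ^ (2 * Suc h)" by (simp add: power_mult)
    then show ?thesis
      using three_central_binomial_le[of h]
      unfolding True binomial_r_part_sum by (simp only: mult_2[symmetric])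
  next
    case False
    have "(\<Sum>i\<le>t. Suc (Suc (2 * h + 1)) choose i) = R t + 2 * R (Suc t') + R t'"
      unfolding R_def t sum_choose_Suc by linarith
    moreover have "3 * ((h + t) choose t) \<le> R t + 2"
      unfolding R_def by (rule Suc.IH) (use Suc.prems False in auto)
    moreover have "3 * ((Suc h + Suc t') choose Suc t') \<le> 2 * R (Suc t') + R t'"
    proof (cases t')
      case 0
      then show ?thesis using Suc.prems False by (simp add: R_def t)
    next
      case (Suc t'')
      have "(h + Suc t') choose t' \<le> (h + Suc t') choose Suc t'"
        by (rule binomial_mono) (use Suc.prems t in auto)
      then have "(Suc h + Suc t') choose Suc t' \<le> 2 * ((h + Suc t') choose Suc t')" by simp
      moreover have "3 * ((h + Suc t') choose Suc t') \<le> R (Suc t') + 2"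
        using Suc.IH[of "Suc t'"] Suc.prems t Suc unfolding R_def by simp
      \<comment> \<open>Pays for the additive \<open>2\<close> of the induction hypothesis, which is
        doubled here.\<close>
      moreover have "4 \<le> R t'"
      proof -
        have "(\<Sum>i\<le>1. (2 * h + 1) choose i) \<le> R t'"
          unfolding R_def by (rule sum_mono2) (use Suc in auto)
        then show ?thesis using Suc.prems t by simp
      qed
      ultimately show ?thesis by linarith
    qed
    moreover have "(Suc h + t) choose t = ((h + t) choose t) + ((Suc h + Suc t') choose Suc t')"
      by (simp add: t)
    ultimately show ?thesis by simp
  qed
qed simp

lemma hball_half: "hball j (2 * h + 1 + j) h = 2 ^ (2 * h + j)"
  using binomial_r_part_sum[of h] unfolding hball_def by (simp add: power_add)

lemma choose_swap: "(h + t) choose h = (h + t) choose (t :: nat)"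
  using binomial_symmetric[of t "h + t"] by simp

text \<open>Treats both parities at once. Since \<open>n - p - 1 = h - t\<close>, the iterated
  neighbourhood goes from radius \<open>t\<close> to radius \<open>h\<close>, where
  \<open>hball\<close> is exactly half the cube.\<close>

lemma b_chromatic_number_hypercube_power_le:
  assumes "j \<le> 1" "1 \<le> t" "t < h"
  shows "int (b_chromatic_number (hypercube_power (2 * h + 1 + j) (h + t + j)))
    \<le> 2 ^ (2 * h + j) + \<lfloor>(real (hball j (2 * h + 1 + j) t) - real ((h + t) choose t)) / 2\<rfloor>"
proof -
  define n where "n = 2 * h + 1 + j"
  define s where "s = (h + t) choose t"
  define d where "d = hball j n t - s"
  have s: "s \<le> hball j n t"
    unfolding s_def by (rule choose_le_hball) (use assms in \<open>simp add: n_def\<close>)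
  have pow: "(2::nat) ^ n = 2 * 2 ^ (2 * h + j)" unfolding n_def by simp
  have m: "n - (h + t + j) - 1 = h - t" unfolding n_def using assms by simp
  have half: "hball j n h = 2 ^ (2 * h + j)" unfolding n_def by (rule hball_half)
  have N: "2 ^ n \<le> 2 * card ((nbhd n ^^ (n - (h + t + j) - 1)) A) + d"
    if A: "A \<subseteq> Pow {1..n}" "d < card A" for A
  proof (cases "j = 0 \<and> t = 1")
    \<comment> \<open>Here \<open>3 * s \<le> r + 2\<close> fails, but \<open>r - (h choose t) = r - s + 1\<close>, so \<open>q = h\<close> can replace \<open>q = h + t\<close>.\<close>
    case True
    then have "hball j n t - (h choose t) \<le> card A"
      using A(2) unfolding d_def s_def hball_def n_def by simp
    from funpow_nbhd_hball_minus[OF assms(1) _ _ assms(2) A(1) this, of "h - t"]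
    have "2 ^ (2 * h + j) - 1 \<le> card ((nbhd n ^^ (h - t)) A)"
      using assms half by (simp add: n_def)
    \<comment> \<open>At radius \<open>h\<close> the deficit is \<open>h choose h = 1\<close>;
      doubled, it is covered by \<open>d = h + 1\<close>.\<close>
    moreover have "2 \<le> d" using True assms unfolding d_def s_def hball_def n_def by simp
    ultimately show ?thesis unfolding m pow by linarith
  next
    case False
    \<comment> \<open>With \<open>q = h + t\<close> the deficits at radii \<open>t\<close> and
      \<open>h\<close> are both \<open>s\<close>, by symmetry of binomial coefficients.\<close>
    have "hball j n (t + (h - t)) - ((h + t) choose (t + (h - t))) < card ((nbhd n ^^ (h - t)) A)"
      by (rule funpow_nbhd_hball_minus_strict) (use A assms in \<open>auto simp: d_def s_def n_def\<close>)
    then have "2 ^ (2 * h + j) < card ((nbhd n ^^ (h - t)) A) + s"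
      using assms half by (simp add: choose_swap[of h t] s_def)
    moreover have "3 * s \<le> hball j n t + 2"
    proof (cases "t = 1")
      case True
      then have "j = 1" using False assms(1) by simp
      then show ?thesis using True by (simp add: s_def hball_def n_def)
    next
      case t: False
      have "3 * s \<le> (\<Sum>i\<le>t. (2 * h + 1) choose i) + 2"
        unfolding s_def by (rule three_choose_le) (use t assms in auto)
      also have "\<dots> \<le> hball j n t + 2" unfolding hball_def n_def by simp
      finally show ?thesis .
    qed
    ultimately show ?thesis unfolding m pow d_def using s by linarith
  qed
  have "2 * k \<le> 2 ^ n + d" if "b_coloring (hypercube_power n (h + t + j)) k c" for k c
    by (rule b_coloring_bound[OF that _ N]) (use assms in \<open>simp_all add: n_def\<close>)
  then have "int (b_chromatic_number (hypercube_power n (h + t + j))) \<le> 2 ^ (n - 1) + \<lfloor>real d / 2\<rfloor>"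
    by (intro b_chromatic_number_le) (use assms in \<open>simp_all add: n_def\<close>)
  then show ?thesis unfolding n_def[symmetric] s_def[symmetric] using s by (simp add: d_def n_def)
qed

theorem theorem4p6:
  fixes n p :: nat
  shows
    "(n \<ge> 5 \<and> odd n \<and> (n + 1) div 2 \<le> p \<and> p \<le> n - 2 \<longrightarrow>
      (let r = (\<Sum>i = 0..p - (n - 1) div 2. n choose i);
           s = p choose (p - (n - 1) div 2)
       in int (b_chromatic_number (hypercube_power n p))
            \<le> 2 ^ (n - 1) + \<lfloor>(real r - real s) / 2\<rfloor>))
     \<and>
     (n \<ge> 6 \<and> even n \<and> n div 2 + 1 \<le> p \<and> p \<le> n - 2 \<longrightarrow>
      (let r' = (\<Sum>i = 0..p - n div 2. n choose i) + ((n - 1) choose (p - n div 2));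
           s' = (p - 1) choose (p - n div 2)
       in int (b_chromatic_number (hypercube_power n p))
            \<le> 2 ^ (n - 1) + \<lfloor>(real r' - real s') / 2\<rfloor>))"
proof (intro conjI impI; elim conjE)
  assume a: "n \<ge> 5" "odd n" "(n + 1) div 2 \<le> p" "p \<le> n - 2"
  define h where "h = (n - 1) div 2"
  define t where "t = p - h"
  have n: "n = 2 * h + 1" and p: "p = h + t" and t: "1 \<le> t" "t < h"
    using a unfolding h_def t_def by (auto elim!: oddE)
  from b_chromatic_number_hypercube_power_le[of 0, OF _ t]
  show "let r = (\<Sum>i = 0..p - (n - 1) div 2. n choose i); s = p choose (p - (n - 1) div 2)
    in int (b_chromatic_number (hypercube_power n p)) \<le> 2 ^ (n - 1) + \<lfloor>(real r - real s) / 2\<rfloor>"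
    unfolding Let_def h_def[symmetric] t_def[symmetric] by (simp add: n p hball_def atMost_atLeast0)
next
  assume a: "n \<ge> 6" "even n" "n div 2 + 1 \<le> p" "p \<le> n - 2"
  define h where "h = n div 2 - 1"
  define t where "t = p - n div 2"
  have n: "n = 2 * h + 1 + 1" and p: "p = h + t + 1" and t: "1 \<le> t" "t < h"
    using a unfolding h_def t_def by (auto elim!: evenE)
  \<comment> \<open>The extra binomial in \<open>r'\<close> completes the sum to twice a ball in
    dimension \<open>n - 1\<close>, which is the case \<open>j = 1\<close>.\<close>
  have "(\<Sum>i\<le>t. Suc k choose i) + (k choose t) = 2 * (\<Sum>i\<le>t. k choose i)" for k t
    by (induction t) auto
  then have r: "(\<Sum>i = 0..t. n choose i) + ((n - 1) choose t) = hball 1 n t"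
    by (simp add: n hball_def atMost_atLeast0)
  from b_chromatic_number_hypercube_power_le[of 1, OF _ t]
  show "let r' = (\<Sum>i = 0..p - n div 2. n choose i) + ((n - 1) choose (p - n div 2));
      s' = (p - 1) choose (p - n div 2)
    in int (b_chromatic_number (hypercube_power n p)) \<le> 2 ^ (n - 1) + \<lfloor>(real r' - real s') / 2\<rfloor>"
    unfolding Let_def t_def[symmetric] r by (simp add: n p)
qed

end
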